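(* Let $D^*=(V,A^* )$ be a minimal strong digraph of order $n\geq 3$ and let $v\in V$ be a linear vertex of $D^*$. Then there exists a minimal strong digraph $D=(V\setminus\{v\},A)$ such that $D^*$ is either an internal expansion of $D$ by the vertex $v$ over some arc $uw\in A$, or an external expansion of $D$ by the vertex $v$ from some vertex $u$ to some vertex $w$ of $D$.
   Context: A digraph is a pair $D=(V,A)$ with $V$ a finite nonempty set and $A\subseteq V\times V\setminus\{(x,x):x\in V\}$; the arc $(x,y)$ is written $xy$. A digraph is strong if for every ordered pair of vertices $x,y$ there is a directed path from $x$ to $y$. A strong digraph is minimal strong if deleting any single arc yields a digraph that is not strong. A linear vertex is a vertex with indegree and outdegree both equal to $1$. For a digraph $D=(V,A)$ and a vertex $v\notin V$: the internal expansion of $D$ by $v$ over the arc $uw\in A$ is $i_{uw}(D)=(V\cup\{v\},\,(A\cup\{uv,vw\})\setminus\{uw\})$; the external expansion of $D$ by $v$ from $u\in V$ to $w\in V$ ($u,w$ not necessarily distinct) is $e_{uw}(D)=(V\cup\{v\},\,A\cup\{uv,vw\})$. *)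

theory Defs
  imports "Graph_Theory.Digraph_Component"
begin

text \<open>
  A digraph is a \<^const>\<open>pair_digraph\<close>: a finite vertex set together with a set of ordered pairs of
  distinct vertices. Non-emptiness of the vertex set is part of \<^const>\<open>strongly_connected\<close>.
\<close>

definition minimal_strong :: "'a pair_pre_digraph \<Rightarrow> bool" where
  "minimal_strong D \<longleftrightarrow>
     pair_digraph D \<and> strongly_connected (with_proj D) \<and>
     (\<forall>a \<in> parcs D. \<not> strongly_connected (pre_digraph.del_arc (with_proj D) a))"

definition linear_vertex :: "'a pair_pre_digraph \<Rightarrow> 'a \<Rightarrow> bool" where
  "linear_vertex D v \<longleftrightarrow>
     v \<in> pverts D \<and> in_degree (with_proj D) v = 1 \<and> out_degree (with_proj D) v = 1"

text \<open>
  Both expansions are meant for \<open>v \<notin> pverts D\<close>; the internal one for \<open>(u, w) \<in> parcs D\<close>, the external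
  one for \<open>u, w \<in> pverts D\<close> (possibly \<open>u = w\<close>).
\<close>

definition internal_expansion ::
    "'a pair_pre_digraph \<Rightarrow> 'a \<Rightarrow> 'a \<Rightarrow> 'a \<Rightarrow> 'a pair_pre_digraph" where
  "internal_expansion D v u w =
     \<lparr> pverts = pverts D \<union> {v}, parcs = (parcs D \<union> {(u, v), (v, w)}) - {(u, w)} \<rparr>"

definition external_expansion ::
    "'a pair_pre_digraph \<Rightarrow> 'a \<Rightarrow> 'a \<Rightarrow> 'a \<Rightarrow> 'a pair_pre_digraph" where
  "external_expansion D v u w =
     \<lparr> pverts = pverts D \<union> {v}, parcs = parcs D \<union> {(u, v), (v, w)} \<rparr>"

end

theory Submission
  imports Defs
begin

text \<open>
  Let \<open>u\<close> and \<open>w\<close> be the unique in- and out-neighbour of the linear vertex \<open>v\<close>, and let \<open>B\<close> be the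
  set of arcs avoiding \<open>v\<close>. A digraph with arcs \<open>B' \<union> {uv, vw}\<close> is strong iff \<open>B' \<union> {uw}\<close> is strong on
  the remaining vertices. If \<open>B\<close> itself is strong, it is minimal strong and yields an external
  expansion; otherwise \<open>u \<noteq> w\<close> and \<open>uw \<notin> B\<close>, and \<open>B \<union> {uw}\<close> yields an internal expansion.
\<close>

text \<open>Library reachability uses \<open>rtrancl_on\<close>, confined to the vertex set. As arcs
  have both ends there, a walk starting at a vertex never leaves the set, so the plain closure
  agrees; this allows the rest to work with bare arc sets.\<close>

lemma strongly_connected_iff_rtrancl:
  assumes "arcs_ends G \<subseteq> verts G \<times> verts G"
  shows "strongly_connected G \<longleftrightarrow> verts G \<noteq> {} \<and> verts G \<times> verts G \<subseteq> (arcs_ends G)\<^sup>*"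
proof -
  have "(x, y) \<in> rtrancl_on (verts G) (arcs_ends G) \<longleftrightarrow> (x, y) \<in> (arcs_ends G)\<^sup>*"
    if "x \<in> verts G" for x y
  proof
    assume "(x, y) \<in> rtrancl_on (verts G) (arcs_ends G)"
    then show "(x, y) \<in> (arcs_ends G)\<^sup>*"
      by (induction rule: rtrancl_on_induct) auto
  next
    assume "(x, y) \<in> (arcs_ends G)\<^sup>*"
    then show "(x, y) \<in> rtrancl_on (verts G) (arcs_ends G)"
      by induction (use assms that in \<open>auto intro: rtrancl_on_into_rtrancl_on\<close>)
  qed
  then show ?thesis
    by (auto simp: strongly_connected_def reachable_def)
qed

lemma arcs_ends_del_arc_with_proj:
  "arcs_ends (pre_digraph.del_arc (with_proj D) a) = parcs D - {a}"
  by (auto simp: arcs_ends_def arc_to_ends_def pre_digraph.del_arc_def)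

lemma minimal_strong_iff_rtrancl:
  assumes "pair_digraph D"
  shows "minimal_strong D \<longleftrightarrow>
    pverts D \<noteq> {} \<and> pverts D \<times> pverts D \<subseteq> (parcs D)\<^sup>* \<and>
    (\<forall>a \<in> parcs D. \<not> pverts D \<times> pverts D \<subseteq> (parcs D - {a})\<^sup>*)"
proof -
  interpret pair_digraph D by fact
  have sub: "parcs D \<subseteq> pverts D \<times> pverts D"
    by (auto dest: in_arcsD1 in_arcsD2)
  have "strongly_connected (with_proj D) \<longleftrightarrow>
      pverts D \<noteq> {} \<and> pverts D \<times> pverts D \<subseteq> (parcs D)\<^sup>*"
    using strongly_connected_iff_rtrancl[of "with_proj D"] sub by simp
  moreover have "strongly_connected (pre_digraph.del_arc (with_proj D) a) \<longleftrightarrow>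
      pverts D \<noteq> {} \<and> pverts D \<times> pverts D \<subseteq> (parcs D - {a})\<^sup>*" for a
    using strongly_connected_iff_rtrancl[of "pre_digraph.del_arc (with_proj D) a"] sub
    unfolding arcs_ends_del_arc_with_proj by (auto simp: pre_digraph.del_arc_def)
  ultimately show ?thesis
    using assms by (auto simp: minimal_strong_def)
qed

text \<open>Contract \<open>v\<close> into \<open>u\<close>: a step from \<open>u\<close> to
  \<open>v\<close> becomes standing still, a step from \<open>v\<close> to \<open>w\<close> becomes
  the arc \<open>(u, w)\<close>. The \<open>if\<close> lets the induction pass through prefixes that
  end at \<open>v\<close>.\<close>

lemma rtrancl_contract_vertex:
  assumes "(x, y) \<in> (B \<union> {(u, v), (v, w)})\<^sup>*" and "v \<notin> Field B" and "x \<noteq> v" "u \<noteq> v"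
  shows "(x, if y = v then u else y) \<in> (B \<union> {(u, w)})\<^sup>*"
  using assms(1)
proof induction
  case base
  then show ?case using \<open>x \<noteq> v\<close> by simp
next
  case (step y z)
  consider "(y, z) \<in> B" "y \<noteq> v" "z \<noteq> v" | "y = u" "z = v" | "y = v" "z = w"
    using step.hyps(2) \<open>v \<notin> Field B\<close> by (auto simp: Field_def)
  then show ?case
  proof cases
    case 1
    then have "(y, z) \<in> B \<union> {(u, w)}" by simp
    with step.IH 1 show ?thesis by (auto intro: rtrancl_into_rtrancl)
  next
    case 2
    with step.IH \<open>u \<noteq> v\<close> show ?thesis by simp
  next
    case 3
    have "(u, w) \<in> B \<union> {(u, w)}" by simp
    with step.IH 3 show ?thesis by (auto intro: rtrancl_into_rtrancl)
  qed
qed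

text \<open>Forwards, walks through \<open>v\<close> are contracted; backwards,
  \<open>(u, w)\<close> is replaced by the detour via \<open>v\<close>, which is itself entered from
  \<open>u\<close> and left to \<open>w\<close>. With \<open>B\<close> arbitrary, this applies both
  to the full arc set and after deleting an arc.\<close>

lemma strong_subdivide_iff:
  assumes "B \<subseteq> V \<times> V" and "v \<notin> V" and "u \<in> V" "w \<in> V"
  shows "insert v V \<times> insert v V \<subseteq> (B \<union> {(u, v), (v, w)})\<^sup>* \<longleftrightarrow> V \<times> V \<subseteq> (B \<union> {(u, w)})\<^sup>*"
    (is "_ \<subseteq> ?R\<^sup>* \<longleftrightarrow> _ \<subseteq> ?S\<^sup>*")
proof
  assume strong: "insert v V \<times> insert v V \<subseteq> ?R\<^sup>*"
  show "V \<times> V \<subseteq> ?S\<^sup>*"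
  proof clarify
    fix x y assume "x \<in> V" "y \<in> V"
    moreover from this have "(x, y) \<in> ?R\<^sup>*" using strong by blast
    moreover have "v \<notin> Field B" using assms by (auto simp: Field_def)
    moreover have "x \<noteq> v" "y \<noteq> v" "u \<noteq> v" using assms \<open>x \<in> V\<close> \<open>y \<in> V\<close> by auto
    ultimately show "(x, y) \<in> ?S\<^sup>*"
      using rtrancl_contract_vertex[of x y B u v w] by simp
  qed
next
  assume strong: "V \<times> V \<subseteq> ?S\<^sup>*"
  have uv: "(u, v) \<in> ?R\<^sup>*" and vw: "(v, w) \<in> ?R\<^sup>*" by auto
  then have "(u, w) \<in> ?R\<^sup>*" by (rule rtrancl_trans)
  then have "?S \<subseteq> ?R\<^sup>*" by auto
  then have "?S\<^sup>* \<subseteq> ?R\<^sup>*" by (rule rtrancl_subset_rtrancl)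
  with strong have VV: "(x, y) \<in> ?R\<^sup>*" if "x \<in> V" "y \<in> V" for x y
    using that by blast
  have "(x, v) \<in> ?R\<^sup>*" if "x \<in> V" for x
    using VV[OF that \<open>u \<in> V\<close>] uv by (rule rtrancl_trans)
  moreover have "(v, y) \<in> ?R\<^sup>*" if "y \<in> V" for y
    using vw VV[OF \<open>w \<in> V\<close> that] by (rule rtrancl_trans)
  ultimately show "insert v V \<times> insert v V \<subseteq> ?R\<^sup>*"
    using VV by blast
qed

text \<open>Degree one makes the sets of arcs into and out of \<open>v\<close> singletons, and the
  absence of loops keeps \<open>u\<close> and \<open>w\<close> distinct from \<open>v\<close>. The
  case \<open>u = w\<close> remains possible.\<close>

lemma (in pair_digraph) linear_vertex_arcs:
  assumes "linear_vertex G v"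
  obtains u w where "u \<in> pverts G - {v}" "w \<in> pverts G - {v}"
    "parcs G = {e \<in> parcs G. fst e \<noteq> v \<and> snd e \<noteq> v} \<union> {(u, v), (v, w)}"
proof -
  have "card {e \<in> parcs G. snd e = v} = 1" "card {e \<in> parcs G. fst e = v} = 1"
    using assms by (auto simp: linear_vertex_def in_degree_def out_degree_def in_arcs_def out_arcs_def)
  then obtain e f where e: "{e \<in> parcs G. snd e = v} = {e}" and f: "{e \<in> parcs G. fst e = v} = {f}"
    by (auto simp: card_1_singleton_iff)
  have "e \<in> parcs G" "snd e = v" "f \<in> parcs G" "fst f = v"
    using e f by blast+
  then obtain u w where uv: "e = (u, v)" and vw: "f = (v, w)"
    and arcs: "(u, v) \<in> parcs G" "(v, w) \<in> parcs G"
    by (metis prod.collapse)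
  show thesis
  proof
    show "u \<in> pverts G - {v}" "w \<in> pverts G - {v}"
      using arcs by (auto dest: in_arcsD1 in_arcsD2 no_loops')
    show "parcs G = {e \<in> parcs G. fst e \<noteq> v \<and> snd e \<noteq> v} \<union> {(u, v), (v, w)}"
      using e f uv vw by blast
  qed
qed

lemma pair_digraphI:
  assumes "finite V" "B \<subseteq> V \<times> V" "\<And>x. (x, x) \<notin> B"
  shows "pair_digraph \<lparr>pverts = V, parcs = B\<rparr>"
proof -
  have "finite B"
    using finite_subset[OF assms(2)] assms(1) by simp
  moreover have "fst e \<noteq> snd e" if "e \<in> B" for e
    using assms(3)[of "fst e"] that by (cases e) auto
  ultimately show ?thesis
    using assms(1,2) by unfold_locales auto
qed

theorem theorem3p4:
  fixes Dstar :: "'a pair_pre_digraph" and v :: 'a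
  assumes "minimal_strong Dstar"
    and "card (pverts Dstar) \<ge> 3"
    and "linear_vertex Dstar v"
  shows "\<exists>D :: 'a pair_pre_digraph.
           minimal_strong D \<and> pverts D = pverts Dstar - {v} \<and>
           ((\<exists>u w. (u, w) \<in> parcs D \<and> Dstar = internal_expansion D v u w) \<or>
            (\<exists>u \<in> pverts D. \<exists>w \<in> pverts D. Dstar = external_expansion D v u w))"
proof -
  interpret pair_digraph Dstar
    using assms(1) by (simp add: minimal_strong_def)
  define V where "V = pverts Dstar - {v}"
  define B where "B = {e \<in> parcs Dstar. fst e \<noteq> v \<and> snd e \<noteq> v}"
  obtain u w where u: "u \<in> V" and w: "w \<in> V"
    and arcs: "parcs Dstar = B \<union> {(u, v), (v, w)}"
    unfolding V_def B_def by (rule linear_vertex_arcs[OF assms(3)])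
  have verts: "pverts Dstar = insert v V" and v: "v \<notin> V"
    using assms(3) by (auto simp: V_def linear_vertex_def)
  have B: "B \<subseteq> V \<times> V"
    by (auto simp: B_def V_def dest: in_arcsD1 in_arcsD2)
  have loop: "(x, x) \<notin> B" for x
    using no_loops'[of x x] by (auto simp: B_def)
  have fin: "finite V"
    using pair_finite_verts by (simp add: V_def)
  have Dstar_eq: "Dstar = \<lparr>pverts = insert v V, parcs = B \<union> {(u, v), (v, w)}\<rparr>"
    using verts arcs by (intro pair_pre_digraph.equality) simp_all
  have strong: "V \<times> V \<subseteq> (B \<union> {(u, w)})\<^sup>*"
    using assms(1) strong_subdivide_iff[OF B v u w]
    by (simp add: minimal_strong_iff_rtrancl[OF pair_digraph_axioms] verts arcs)
  \<comment> \<open>Deleting \<open>a\<close> leaves both arcs at \<open>v\<close> in place, so the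
    failure of strongness in \<open>Dstar\<close> carries over through the subdivision equivalence
    for \<open>B - {a}\<close>.\<close>
  have minimal: "\<not> V \<times> V \<subseteq> (B - {a} \<union> {(u, w)})\<^sup>*" if "a \<in> B" for a
  proof -
    have "parcs Dstar - {a} = B - {a} \<union> {(u, v), (v, w)}"
      using that B v arcs by auto
    moreover have "\<not> insert v V \<times> insert v V \<subseteq> (parcs Dstar - {a})\<^sup>*"
      using assms(1) that arcs by (simp add: minimal_strong_iff_rtrancl[OF pair_digraph_axioms] verts)
    ultimately show ?thesis
      using strong_subdivide_iff[of "B - {a}" V v u w] B v u w by auto
  qed
  show ?thesis
  proof (cases "V \<times> V \<subseteq> B\<^sup>*")
    case True
    let ?D = "\<lparr>pverts = V, parcs = B\<rparr>"
    \<comment> \<open>Fewer arcs cannot restore strongness, so \<open>minimal\<close> survives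
      dropping \<open>(u, w)\<close>.\<close>
    have "\<not> V \<times> V \<subseteq> (B - {a})\<^sup>*" if "a \<in> B" for a
      using minimal[OF that] rtrancl_mono[of "B - {a}" "B - {a} \<union> {(u, w)}"] by blast
    then have "minimal_strong ?D"
      using True u by (auto simp: minimal_strong_iff_rtrancl[OF pair_digraphI[OF fin B loop]])
    moreover have "Dstar = external_expansion ?D v u w"
      by (simp add: external_expansion_def Dstar_eq)
    ultimately show ?thesis
      using u w unfolding V_def[symmetric]
      by (metis pair_pre_digraph.select_convs(1))
  next
    case False
    let ?D = "\<lparr>pverts = V, parcs = B \<union> {(u, w)}\<rparr>"
    have uw: "(u, w) \<notin> B"
      using False strong by (auto simp: insert_absorb)
    have "u \<noteq> w"
    proof
      assume "u = w"
      \<comment> \<open>The added pair would be a loop, already in the reflexive closure, so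
        \<open>B\<close> alone would be strong.\<close>
      then have "B \<union> {(u, w)} \<subseteq> B\<^sup>*" by auto
      then show False using False strong rtrancl_subset_rtrancl by blast
    qed
    then have D: "pair_digraph ?D"
      using B u w loop fin by (intro pair_digraphI) auto
    have "\<not> V \<times> V \<subseteq> (B \<union> {(u, w)} - {a})\<^sup>*" if "a \<in> B \<union> {(u, w)}" for a
    \<comment> \<open>Deleting the new arc gives back \<open>B\<close>, not strong in this case; any
      other arc falls under \<open>minimal\<close>.\<close>
    proof (cases "a = (u, w)")
      case True
      then have "B \<union> {(u, w)} - {a} = B" using uw by auto
      then show ?thesis using False by metis
    next
      case a: False
      then have "B \<union> {(u, w)} - {a} = B - {a} \<union> {(u, w)}" by auto
      then show ?thesis using minimal[of a] that a by auto
    qed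
    then have "minimal_strong ?D"
      unfolding minimal_strong_iff_rtrancl[OF D] using strong u by auto
    \<comment> \<open>Since \<open>(u, w)\<close> is not in \<open>B\<close>, the removal of
      \<open>(u, w)\<close> in the expansion leaves all of \<open>B\<close> intact.\<close>
    moreover have "Dstar = internal_expansion ?D v u w"
      using uw u w v by (auto simp: internal_expansion_def Dstar_eq)
    ultimately show ?thesis
      unfolding V_def[symmetric]
      by (metis UnI2 insertI1 pair_pre_digraph.select_convs)
  qed
qed

end
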